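(* Consider positive constants $\ell$ and $r$, a point $\bar x\in\mathbb{R}^n$, and a set-valued mapping $F:\mathbb{R}^n\rightrightarrows\mathbb{R}^n$ with $\mathrm{dom}\,F=\mathbb{B}[\bar x,2r]$, and let $\bar y\in F(\bar x)$. Assume that $F$ is upper semicontinuous, has compact convex values, and that for all $x,x'\in\mathbb{B}[\bar x,2r]$ and every $y\in F(x)$ there exists $y'\in F(x')$ such that $$\langle y-y',x'-x\rangle\ge\ell\|x'-x\|^2.$$ Then $\mathrm{sur}\,F(\bar x,\bar y)\ge\ell$; more precisely, $$\mathbb{B}[y,\ell t]\subset F(\mathbb{B}[x,t])\quad\text{whenever}\quad (x,y)\in\big(\mathbb{B}[\bar x,r]\times\mathbb{B}[\bar y,r]\big)\cap\mathrm{gph}\,F\ \text{ and }\ t\in(0,r].$$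
   Context: $\mathbb{R}^n$ carries the Euclidean inner product $\langle\cdot,\cdot\rangle$ and norm; $\mathbb{B}[u,r]$ is the closed ball. $\mathrm{dom}\,F=\{x:F(x)\neq\emptyset\}$, $\mathrm{gph}\,F=\{(x,y):y\in F(x)\}$, $F(C)=\bigcup_{x\in C}F(x)$. Upper semicontinuity of $F$ (on its domain): for each $x\in\mathrm{dom}\,F$ and each open set $O\supset F(x)$ there is a neighborhood $U$ of $x$ with $F(u)\subset O$ for all $u\in U$. $\mathrm{sur}\,F(\bar x,\bar y)$ (modulus of surjection, for $\bar y\in F(\bar x)$) is the supremum of all $c>0$ for which there are $\varepsilon>0$ and a neighborhood $U\times V$ of $(\bar x,\bar y)$ such that $\mathbb{B}[y,ct]\subset F(\mathbb{B}[x,t])$ whenever $(x,y)\in U\times V$, $y\in F(x)$ and $t\in(0,\varepsilon)$ ($\sup\emptyset=0$). *)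

theory Defs
  imports "HOL-Analysis.Analysis"
begin

text \<open>A set-valued mapping is a function into sets; undefinedness at a point is the empty value.\<close>

definition sv_dom :: "('a \<Rightarrow> 'b set) \<Rightarrow> 'a set"
  where "sv_dom F = {x. F x \<noteq> {}}"

definition sv_graph :: "('a \<Rightarrow> 'b set) \<Rightarrow> ('a \<times> 'b) set"
  where "sv_graph F = {(x, y). y \<in> F x}"

definition sv_image :: "('a \<Rightarrow> 'b set) \<Rightarrow> 'a set \<Rightarrow> 'b set"
  where "sv_image F C = (\<Union>x\<in>C. F x)"

text \<open>The neighbourhood ranges over the whole space, not just over the domain; this makes no
  difference, since the inclusion is trivial where the value is empty.\<close>

definition sv_usc :: "('a::topological_space \<Rightarrow> 'b::topological_space set) \<Rightarrow> bool"
  where "sv_usc F \<longleftrightarrow>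
    (\<forall>x\<in>sv_dom F. \<forall>W. open W \<longrightarrow> F x \<subseteq> W \<longrightarrow>
       (\<exists>U. open U \<and> x \<in> U \<and> (\<forall>u\<in>U. F u \<subseteq> W)))"

text \<open>The supremum may be infinite, so it is taken in the type \<open>ennreal\<close>, where the supremum
  of the empty set is 0. Only positive \<open>c\<close> occur, so \<open>ennreal c\<close> never truncates.
  The definition is meant for \<open>ybar \<in> F xbar\<close>.\<close>

definition sur :: "('a::metric_space \<Rightarrow> 'b::metric_space set) \<Rightarrow> 'a \<Rightarrow> 'b \<Rightarrow> ennreal"
  where "sur F xbar ybar =
    Sup {ennreal c | c. c > 0 \<and>
      (\<exists>\<epsilon>>0. \<exists>U V. open U \<and> xbar \<in> U \<and> open V \<and> ybar \<in> V \<and>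
        (\<forall>x\<in>U. \<forall>y\<in>V. y \<in> F x \<longrightarrow>
          (\<forall>t\<in>{0<..<\<epsilon>}. cball y (c * t) \<subseteq> sv_image F (cball x t))))}"

end

theory Submission
  imports Defs
begin

text \<open>
  Fix \<open>y \<in> F x\<close> and a target \<open>z\<close> with \<open>norm (z - y) \<le> l * t\<close>, and suppose that no value of \<open>F\<close> on the
  ball \<open>B = cball x t\<close> contains \<open>z\<close>. The values are closed and convex, so each of them can be
  strictly separated from \<open>z\<close>. By upper semicontinuity a separating direction for \<open>F u\<close> also works
  for all nearby values, and finitely many bump functions on the compact ball glue these directions into
  a continuous field \<open>p\<close> with \<open>p u \<bullet> (v - z) > 0\<close> for all \<open>u \<in> B\<close> and \<open>v \<in> F u\<close>
  (\<open>continuous_strict_separation\<close>). Gluing is possible because the directions that separate a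
  given set from \<open>z\<close> form a convex cone.

  Brouwer's theorem, applied to \<open>u \<mapsto> x + t *\<^sub>R sgn (p u)\<close>, gives a point \<open>u\<close> of the sphere around \<open>x\<close>
  at which \<open>p u\<close> points radially outwards. Hence every \<open>v \<in> F u\<close> satisfies
  \<open>(v - z) \<bullet> (u - x) > 0\<close>. The monotonicity hypothesis from \<open>(x, y)\<close> to \<open>u\<close> supplies a \<open>v \<in> F u\<close> with
  \<open>(v - y) \<bullet> (u - x) \<le> - l * t\<^sup>2\<close>, while \<open>(y - z) \<bullet> (u - x) \<le> l * t\<^sup>2\<close> by Cauchy-Schwarz; adding
  the two contradicts the strict inequality. So \<open>z\<close> is attained on \<open>B\<close>
  (\<open>cball_subset_image_of_monotone\<close>).
\<close>

text \<open>The separating directions are local constants \<open>a d\<close>, valid on balls \<open>ball d (e d)\<close>; finitely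
  many of these balls cover \<open>B\<close>, and the weights below are the usual bump functions. They are not
  normalised, because scaling \<open>p u\<close> by a positive factor preserves the conclusion.\<close>

lemma continuous_strict_separation:
  fixes F :: "'a::metric_space \<Rightarrow> 'b::euclidean_space set"
  assumes "compact B" and dom: "B \<subseteq> sv_dom F" and usc: "sv_usc F"
    and closed: "\<And>u. u \<in> B \<Longrightarrow> closed (F u)" and convex: "\<And>u. u \<in> B \<Longrightarrow> convex (F u)"
    and z: "\<And>u. u \<in> B \<Longrightarrow> z \<notin> F u"
  obtains p where "continuous_on B p" and "\<And>u v. u \<in> B \<Longrightarrow> v \<in> F u \<Longrightarrow> p u \<bullet> (v - z) > 0"
proof -
  have "\<exists>a e. e > 0 \<and> (\<forall>w\<in>ball u e. \<forall>v\<in>F w. a \<bullet> (v - z) > 0)" if u: "u \<in> B" for u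
  proof -
    obtain a b where az: "a \<bullet> z < b" and aF: "\<And>v. v \<in> F u \<Longrightarrow> b < a \<bullet> v"
      using separating_hyperplane_closed_point[OF convex[OF u] closed[OF u] z[OF u]] by blast
    have "open {v. b < a \<bullet> v}"
      by (rule open_halfspace_gt)
    moreover have "F u \<subseteq> {v. b < a \<bullet> v}"
      using aF by auto
    ultimately obtain U where "open U" "u \<in> U" and U: "\<And>w. w \<in> U \<Longrightarrow> F w \<subseteq> {v. b < a \<bullet> v}"
      using usc dom u unfolding sv_usc_def by (metis subsetD)
    then obtain e where "e > 0" and "ball u e \<subseteq> U"
      using open_contains_ball by metis
    then have "\<forall>w\<in>ball u e. \<forall>v\<in>F w. a \<bullet> (v - z) > 0"
      using U az by (fastforce simp: inner_diff_right)
    with \<open>e > 0\<close> show ?thesis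
      by blast
  qed
  then obtain a e where e: "\<And>u. u \<in> B \<Longrightarrow> e u > 0"
    and a: "\<And>u w v. u \<in> B \<Longrightarrow> w \<in> ball u (e u) \<Longrightarrow> v \<in> F w \<Longrightarrow> a u \<bullet> (v - z) > 0"
    by metis
  have "B \<subseteq> (\<Union>u\<in>B. ball u (e u))"
    using e by force
  then obtain D where D: "D \<subseteq> B" "finite D" and cover: "B \<subseteq> (\<Union>d\<in>D. ball d (e d))"
    using compactE_image[OF \<open>compact B\<close>, of B "\<lambda>u. ball u (e u)"] by auto
  define p where "p w = (\<Sum>d\<in>D. max 0 (e d - dist d w) *\<^sub>R a d)" for w
  show ?thesis
  proof
    show "continuous_on B p"
      unfolding p_def by (intro continuous_intros)
    fix u v
    assume u: "u \<in> B" and v: "v \<in> F u"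
    have term_pos: "0 < max 0 (e d - dist d u) * (a d \<bullet> (v - z))" if "d \<in> D" "dist d u < e d" for d
      using that a[of d u v] D v by auto
    then have term_nonneg: "0 \<le> max 0 (e d - dist d u) * (a d \<bullet> (v - z))" if "d \<in> D" for d
      using that by (cases "dist d u < e d") (auto simp: less_imp_le)
    obtain d where "d \<in> D" "dist d u < e d"
      using cover u by auto
    then have "0 < (\<Sum>d\<in>D. max 0 (e d - dist d u) * (a d \<bullet> (v - z)))"
      using term_pos term_nonneg D(2) by (meson sum_pos2)
    then show "p u \<bullet> (v - z) > 0"
      by (simp add: p_def inner_sum_left)
  qed
qed

text \<open>The field points radially outwards at any fixed point of the self-map \<open>u \<mapsto> x + t *\<^sub>R sgn (p u)\<close> of the ball.\<close>

lemma radial_point_of_nonvanishing_field: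
  fixes p :: "'a::euclidean_space \<Rightarrow> 'a"
  assumes "t \<ge> 0" and "continuous_on (cball x t) p" and "\<And>u. u \<in> cball x t \<Longrightarrow> p u \<noteq> 0"
  obtains u where "u \<in> cball x t" and "u - x = t *\<^sub>R sgn (p u)"
proof -
  have "continuous_on (cball x t) (\<lambda>u. x + t *\<^sub>R sgn (p u))"
    using assms(2,3) by (intro continuous_intros) auto
  moreover have "(\<lambda>u. x + t *\<^sub>R sgn (p u)) \<in> cball x t \<rightarrow> cball x t"
    using \<open>t \<ge> 0\<close> by (auto simp: dist_norm norm_sgn)
  moreover have "cball x t \<noteq> {}"
    using \<open>t \<ge> 0\<close> by simp
  ultimately obtain u where "u \<in> cball x t" "x + t *\<^sub>R sgn (p u) = u"
    using brouwer[OF compact_cball convex_cball] by blast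
  then show ?thesis
    using that by (metis add_diff_cancel_left')
qed

text \<open>A missed target \<open>z\<close> yields a field separating it from the values. At the radial point \<open>u\<close> of
  that field, the hypothesis puts some value of \<open>F u\<close> behind \<open>y\<close> by at least \<open>l * t\<^sup>2\<close>, measured
  along \<open>u - x\<close>; a \<open>z\<close> at distance at most \<open>l * t\<close> from \<open>y\<close> lies behind \<open>y\<close> by at most that much,
  so it cannot be strictly behind all of \<open>F u\<close>.\<close>

lemma cball_subset_image_of_monotone:
  fixes F :: "'a::euclidean_space \<Rightarrow> 'a set"
  assumes "t > 0" and dom: "cball x t \<subseteq> sv_dom F" and usc: "sv_usc F"
    and closed: "\<And>u. u \<in> cball x t \<Longrightarrow> closed (F u)"
    and convex: "\<And>u. u \<in> cball x t \<Longrightarrow> convex (F u)"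
    and mono: "\<And>u. u \<in> cball x t \<Longrightarrow> \<exists>v\<in>F u. (y - v) \<bullet> (u - x) \<ge> l * (norm (u - x))\<^sup>2"
  shows "cball y (l * t) \<subseteq> sv_image F (cball x t)"
proof (rule subsetI, rule ccontr)
  fix z
  assume z: "z \<in> cball y (l * t)" and "z \<notin> sv_image F (cball x t)"
  then have "\<And>u. u \<in> cball x t \<Longrightarrow> z \<notin> F u"
    by (auto simp: sv_image_def)
  then obtain p where cont: "continuous_on (cball x t) p"
    and p: "\<And>u v. u \<in> cball x t \<Longrightarrow> v \<in> F u \<Longrightarrow> p u \<bullet> (v - z) > 0"
    using continuous_strict_separation[OF compact_cball dom usc closed convex] by blast
  have nz: "p u \<noteq> 0" if "u \<in> cball x t" for u
    using p[OF that] mono[OF that] by force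
  obtain u where u: "u \<in> cball x t" and ux: "u - x = t *\<^sub>R sgn (p u)"
    using radial_point_of_nonvanishing_field[OF _ cont nz] \<open>t > 0\<close> by auto
  have norm_ux: "norm (u - x) = t"
    using ux nz[OF u] \<open>t > 0\<close> by (simp add: norm_sgn)
  obtain v where v: "v \<in> F u" and mono_v: "(y - v) \<bullet> (u - x) \<ge> l * t\<^sup>2"
    using mono[OF u] norm_ux by auto
  have "(v - z) \<bullet> (u - x) = (t / norm (p u)) * (p u \<bullet> (v - z))"
    unfolding ux by (simp add: sgn_div_norm inner_commute divide_inverse)
  then have "(v - z) \<bullet> (u - x) > 0"
    using p[OF u v] nz[OF u] \<open>t > 0\<close> by simp
  moreover have "(y - z) \<bullet> (u - x) \<le> l * t\<^sup>2"
  proof -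
    have "(y - z) \<bullet> (u - x) \<le> norm (y - z) * norm (u - x)"
      by (rule norm_cauchy_schwarz)
    also have "\<dots> \<le> (l * t) * t"
      using z \<open>t > 0\<close> by (simp add: norm_ux dist_norm)
    finally show ?thesis
      by (simp add: power2_eq_square mult.assoc)
  qed
  ultimately show False
    using mono_v by (simp add: inner_diff_left)
qed

text \<open>The radii match because \<open>x \<in> cball xbar r\<close> and \<open>t \<le> r\<close> keep \<open>cball x t\<close> inside the domain
  \<open>cball xbar (2 * r)\<close>. The bound on the modulus follows since \<open>l\<close> itself is an admissible constant,
  witnessed by the open balls of radius \<open>r\<close>.\<close>

theorem corollary3p9:
  fixes F :: "real ^ 'n \<Rightarrow> (real ^ 'n) set"
    and xbar ybar :: "real ^ 'n"
    and l r :: real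
  assumes "l > 0" and "r > 0"
    and "sv_dom F = cball xbar (2 * r)"
    and "ybar \<in> F xbar"
    and "sv_usc F"
    and "\<And>x. compact (F x)" and "\<And>x. convex (F x)"
    and "\<And>x x' y. x \<in> cball xbar (2 * r) \<Longrightarrow> x' \<in> cball xbar (2 * r) \<Longrightarrow> y \<in> F x \<Longrightarrow>
           \<exists>y'\<in>F x'. (y - y') \<bullet> (x' - x) \<ge> l * (norm (x' - x))\<^sup>2"
  shows "sur F xbar ybar \<ge> ennreal l \<and>
    (\<forall>x y t. (x, y) \<in> (cball xbar r \<times> cball ybar r) \<inter> sv_graph F \<longrightarrow> t \<in> {0<..r} \<longrightarrow>
       cball y (l * t) \<subseteq> sv_image F (cball x t))"
proof -
  have cover: "cball y (l * t) \<subseteq> sv_image F (cball x t)"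
    if x: "x \<in> cball xbar r" and y: "y \<in> F x" and t: "0 < t" "t \<le> r" for x y t
  proof -
    have sub: "cball x t \<subseteq> cball xbar (2 * r)"
    proof
      fix u
      assume "u \<in> cball x t"
      then show "u \<in> cball xbar (2 * r)"
        using x t dist_triangle[of xbar u x] by simp
    qed
    have "x \<in> cball x t"
      using t by simp
    show ?thesis
      using sub \<open>x \<in> cball x t\<close> assms(3,5,6,7) t y
      by (intro cball_subset_image_of_monotone)
        (auto intro!: assms(8) compact_imp_closed simp del: mem_cball)
  qed
  have "\<exists>\<epsilon>>0. \<exists>U V. open U \<and> xbar \<in> U \<and> open V \<and> ybar \<in> V \<and>
        (\<forall>x\<in>U. \<forall>y\<in>V. y \<in> F x \<longrightarrow>
          (\<forall>t\<in>{0<..<\<epsilon>}. cball y (l * t) \<subseteq> sv_image F (cball x t)))"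
    using \<open>r > 0\<close> cover
    by (intro exI[of _ r] exI[of _ "ball xbar r"] exI[of _ "ball ybar r"] conjI) auto
  then have "sur F xbar ybar \<ge> ennreal l"
    unfolding sur_def using \<open>l > 0\<close> by (intro Sup_upper) blast
  then show ?thesis
    using cover by (auto simp: sv_graph_def simp del: mem_cball)
qed

end
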